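(* Let $(V,b,m)$ be an infinite, locally finite, connected graph over a non-Archimedean ordered field $\mathbb K$ which is Cauchy complete and has countable cofinality. The following statements are equivalent: (i) The graph is not of null capacity. (ii) The Hardy inequality holds for some strictly positive Hardy weight, i.e. there is $\omega:V\to\mathbb K^+$ with $Q(\phi)\succeq\sum_{x\in V}\phi^2(x)\omega(x)$ for all $\phi\in C_c(V)$. (iii) The Hardy inequality holds for some Hardy weight, i.e. there is a function $\omega:V\to\mathbb K^+\cup\{0\}$, not identically zero, with $Q(\phi)\succeq\sum_{x\in V}\phi^2(x)\omega(x)$ for all $\phi\in C_c(V)$. (iv) There exists a function $\omega:V\to\mathbb K^+\cup\{0\}$, not identically zero, such that $$Q(\phi)\succeq\Big(\sum_{x\in V}\phi(x)\omega(x)\Big)^2\qquad\text{for all }\phi\in C_c(V).$$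
   Context: An ordered field $(\mathbb K,\succ)$ is non-Archimedean if there is $\tau\succ0$ with $\tau\prec 1/n$ for all $n\in\mathbb N$. $\mathbb K^+=\{k\in\mathbb K: k\succ0\}$. A sequence $(k_n)$ converges to $k\in\mathbb K$ if for every $c\in\mathbb K^+$ one has $|k_n-k|\preceq c$ for all large $n$. Cauchy complete: every Cauchy sequence converges. Countable cofinality: there is a countable $S\subset\mathbb K$ such that every $k\in\mathbb K$ satisfies $k\preceq s$ for some $s\in S$. A graph $(V,b,m)$ over $\mathbb K$: $V$ is an at most countable set, $m:V\to\mathbb K^+$, and $b:V\times V\to\mathbb K^+\cup\{0\}$ is symmetric with $b(x,x)=0$. Write $x\sim y$ if $b(x,y)\neq0$; locally finite means each vertex has finitely many neighbors; connectedness is with respect to paths $x_0\sim x_1\sim\dots\sim x_n$, and $d$ is the combinatorial graph distance. $B_n(a)=\{x\in V: d(a,x)<n\}$. $C_c(V)$ is the set of finitely supported functions $V\to\mathbb K$, and $Q(\phi)=\frac12\sum_{x,y\in V}(\phi(x)-\phi(y))^2b(x,y)$ for $\phi\in C_c(V)$. Laplacian: $\Delta f(x)=\frac1{m(x)}\sum_{y\in V}(f(x)-f(y))b(x,y)$ for $f:V\to\mathbb K$. For a finite connected $K\subseteq V$ and $a\in K$ there is a unique $v:V\to\mathbb K$ with $\Delta v=0$ on $K\setminus\{a\}$, $v(a)=1$, $v=0$ on $V\setminus K$; put $\mathrm{cap}_K(a)=\Delta v(a)m(a)$ and $\mathrm{cap}_n(a)=\mathrm{cap}_{B_n(a)}(a)$,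 $n\ge1$. The graph has null capacity if $\lim_{n\to\infty}\mathrm{cap}_n(a)=0$ for some (equivalently, all) $a\in V$; otherwise it is not of null capacity (in particular this includes the case that the limit does not exist). *)

theory Defs
  imports "HOL-Library.Countable_Set"
begin

section \<open>Ordered fields\<close>

text \<open>Ordered fields are types of class \<^class>\<open>linordered_field\<close>. That class carries no
  topology, so convergence is defined directly through the order.\<close>

definition non_archimedean :: "'k::linordered_field itself \<Rightarrow> bool" where
  "non_archimedean _ \<longleftrightarrow> (\<exists>\<tau>::'k. \<tau> > 0 \<and> (\<forall>n::nat. n \<ge> 1 \<longrightarrow> \<tau> < 1 / of_nat n))"

definition converges_to :: "(nat \<Rightarrow> 'k::linordered_field) \<Rightarrow> 'k \<Rightarrow> bool" where
  "converges_to s k \<longleftrightarrow> (\<forall>c>0. \<exists>N. \<forall>n\<ge>N. \<bar>s n - k\<bar> \<le> c)"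

definition cauchy_seq :: "(nat \<Rightarrow> 'k::linordered_field) \<Rightarrow> bool" where
  "cauchy_seq s \<longleftrightarrow> (\<forall>c>0. \<exists>N. \<forall>n\<ge>N. \<forall>l\<ge>N. \<bar>s n - s l\<bar> \<le> c)"

definition cauchy_complete :: "'k::linordered_field itself \<Rightarrow> bool" where
  "cauchy_complete _ \<longleftrightarrow> (\<forall>s::nat \<Rightarrow> 'k. cauchy_seq s \<longrightarrow> (\<exists>k. converges_to s k))"

definition countable_cofinality :: "'k::linordered_field itself \<Rightarrow> bool" where
  "countable_cofinality _ \<longleftrightarrow> (\<exists>S::'k set. countable S \<and> (\<forall>k. \<exists>s\<in>S. k \<le> s))"

section \<open>Graphs over an ordered field\<close>

text \<open>A function on \<open>V\<close> is a function on the whole vertex type of which only the values on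
  \<open>V\<close> matter.\<close>

definition weighted_graph ::
  "'v set \<Rightarrow> ('v \<Rightarrow> 'v \<Rightarrow> 'k::linordered_field) \<Rightarrow> ('v \<Rightarrow> 'k) \<Rightarrow> bool" where
  "weighted_graph V b m \<longleftrightarrow>
     countable V \<and>
     (\<forall>x\<in>V. m x > 0) \<and>
     (\<forall>x\<in>V. \<forall>y\<in>V. b x y \<ge> 0) \<and>
     (\<forall>x\<in>V. \<forall>y\<in>V. b x y = b y x) \<and>
     (\<forall>x\<in>V. b x x = 0)"

definition edges :: "'v set \<Rightarrow> ('v \<Rightarrow> 'v \<Rightarrow> 'k::linordered_field) \<Rightarrow> ('v \<times> 'v) set" where
  "edges V b = {(x, y). x \<in> V \<and> y \<in> V \<and> b x y \<noteq> 0}"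

definition locally_finite_graph :: "'v set \<Rightarrow> ('v \<Rightarrow> 'v \<Rightarrow> 'k::linordered_field) \<Rightarrow> bool" where
  "locally_finite_graph V b \<longleftrightarrow> (\<forall>x\<in>V. finite {y \<in> V. b x y \<noteq> 0})"

text \<open>\<open>(x, y) \<in> edges V b ^^ n\<close> says that there is a path \<open>x = x\<^sub>0 \<sim> x\<^sub>1 \<sim> \<dots> \<sim> x\<^sub>n = y\<close>.\<close>

definition connected_graph :: "'v set \<Rightarrow> ('v \<Rightarrow> 'v \<Rightarrow> 'k::linordered_field) \<Rightarrow> bool" where
  "connected_graph V b \<longleftrightarrow> (\<forall>x\<in>V. \<forall>y\<in>V. \<exists>n. (x, y) \<in> edges V b ^^ n)"

text \<open>Only meaningful when \<open>x\<close> and \<open>y\<close> are joined by a path.\<close>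

definition graph_dist :: "'v set \<Rightarrow> ('v \<Rightarrow> 'v \<Rightarrow> 'k::linordered_field) \<Rightarrow> 'v \<Rightarrow> 'v \<Rightarrow> nat" where
  "graph_dist V b x y = (LEAST n. (x, y) \<in> edges V b ^^ n)"

definition graph_ball :: "'v set \<Rightarrow> ('v \<Rightarrow> 'v \<Rightarrow> 'k::linordered_field) \<Rightarrow> nat \<Rightarrow> 'v \<Rightarrow> 'v set" where
  "graph_ball V b n a = {x \<in> V. graph_dist V b a x < n}"

section \<open>Laplacian, energy and capacity\<close>

text \<open>\<^term>\<open>sum' f A\<close> is the sum of the nonzero values of \<open>f\<close> on the possibly infinite set
  \<open>A\<close>, whereas \<^term>\<open>sum f A\<close> would be \<open>0\<close> for every infinite \<open>A\<close>. In a locally finite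
  graph all the sums below have only finitely many nonzero terms.\<close>

definition laplacian ::
  "'v set \<Rightarrow> ('v \<Rightarrow> 'v \<Rightarrow> 'k::linordered_field) \<Rightarrow> ('v \<Rightarrow> 'k) \<Rightarrow> ('v \<Rightarrow> 'k) \<Rightarrow> 'v \<Rightarrow> 'k" where
  "laplacian V b m f x = 1 / m x * sum' (\<lambda>y. (f x - f y) * b x y) V"

definition finitely_supported :: "'v set \<Rightarrow> ('v \<Rightarrow> 'k::linordered_field) set" where
  "finitely_supported V = {\<phi>. finite {x \<in> V. \<phi> x \<noteq> 0}}"

definition energy ::
  "'v set \<Rightarrow> ('v \<Rightarrow> 'v \<Rightarrow> 'k::linordered_field) \<Rightarrow> ('v \<Rightarrow> 'k) \<Rightarrow> 'k" where
  "energy V b \<phi> = 1 / 2 * sum' (\<lambda>(x, y). (\<phi> x - \<phi> y)\<^sup>2 * b x y) (V \<times> V)"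

text \<open>The requirement \<open>v = 0\<close> is imposed on the whole complement of \<open>K\<close>, hence also outside
  \<open>V\<close>, where the value is irrelevant; this makes \<open>v\<close> unique as a function on the vertex
  type.\<close>

definition is_capacity_potential ::
  "'v set \<Rightarrow> ('v \<Rightarrow> 'v \<Rightarrow> 'k::linordered_field) \<Rightarrow> ('v \<Rightarrow> 'k) \<Rightarrow> 'v set \<Rightarrow> 'v \<Rightarrow> ('v \<Rightarrow> 'k) \<Rightarrow> bool"
where
  "is_capacity_potential V b m K a v \<longleftrightarrow>
     (\<forall>x\<in>K - {a}. laplacian V b m v x = 0) \<and> v a = 1 \<and> (\<forall>x. x \<notin> K \<longrightarrow> v x = 0)"

definition capacity ::
  "'v set \<Rightarrow> ('v \<Rightarrow> 'v \<Rightarrow> 'k::linordered_field) \<Rightarrow> ('v \<Rightarrow> 'k) \<Rightarrow> 'v set \<Rightarrow> 'v \<Rightarrow> 'k" where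
  "capacity V b m K a = laplacian V b m (THE v. is_capacity_potential V b m K a v) a * m a"

text \<open>The capacity of the empty ball of radius \<open>0\<close> is a junk value, which does not affect the
  limit.\<close>

definition null_capacity ::
  "'v set \<Rightarrow> ('v \<Rightarrow> 'v \<Rightarrow> 'k::linordered_field) \<Rightarrow> ('v \<Rightarrow> 'k) \<Rightarrow> bool" where
  "null_capacity V b m \<longleftrightarrow>
     (\<exists>a\<in>V. converges_to (\<lambda>n. capacity V b m (graph_ball V b n a) a) 0)"

definition hardy_inequality ::
  "'v set \<Rightarrow> ('v \<Rightarrow> 'v \<Rightarrow> 'k::linordered_field) \<Rightarrow> ('v \<Rightarrow> 'k) \<Rightarrow> bool" where
  "hardy_inequality V b \<omega> \<longleftrightarrow>
     (\<forall>\<phi>\<in>finitely_supported V. energy V b \<phi> \<ge> sum' (\<lambda>x. (\<phi> x)\<^sup>2 * \<omega> x) V)"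

end

theory Submission
  imports Defs
begin

text \<open>Write \<open>P(a)\<close> for the existence of \<open>c > 0\<close> with \<open>Q(\<phi>) \<ge> c \<phi>(a)\<^sup>2\<close> for all finitely supported
  \<open>\<phi>\<close>. By Green's formula the capacity of a finite set \<open>K\<close> at \<open>a\<close> is the minimum of \<open>Q(\<phi>)\<close> over the
  \<open>\<phi>\<close> supported in \<open>K\<close> with \<open>\<phi>(a) = 1\<close>; as balls exhaust \<open>V\<close>, the capacities at \<open>a\<close> tend to \<open>0\<close> iff \<open>P(a)\<close>
  fails. Since \<open>Q(\<phi>)\<close> controls the increment of \<open>\<phi>\<close> along an edge, \<open>P\<close> at one vertex gives \<open>P\<close> at
  all of them, with constants \<open>c\<^sub>x\<close>, and \<open>c\<^sub>x / 2\<^sup>n\<^sup>+\<^sup>1\<close> at the \<open>n\<close>-th vertex \<open>x\<close> is then a strictly positive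
  Hardy weight. Conversely a weight that is positive at \<open>a\<close> gives \<open>P(a)\<close>; in the case of (iv) one
  passes from \<open>\<phi>\<close> to \<open>\<bar>\<phi>\<bar>\<close>, which does not increase the energy and leaves no cancellation in
  \<open>\<Sum>\<phi>\<omega>\<close>.\<close>

section \<open>Reduction of energy and Laplacian to finite sums\<close>

locale locally_finite_weighted_graph =
  fixes V :: "'v set"
    and b :: "'v \<Rightarrow> 'v \<Rightarrow> 'k::linordered_field"
    and m :: "'v \<Rightarrow> 'k"
  assumes weighted: "weighted_graph V b m"
    and locally_finite: "locally_finite_graph V b"
    and connected: "connected_graph V b"
begin

lemma m_pos: "x \<in> V \<Longrightarrow> m x > 0"
  and b_nonneg: "x \<in> V \<Longrightarrow> y \<in> V \<Longrightarrow> b x y \<ge> 0"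
  and b_sym: "x \<in> V \<Longrightarrow> y \<in> V \<Longrightarrow> b x y = b y x"
  and countable_V: "countable V"
  using weighted by (auto simp: weighted_graph_def)

text \<open>For \<open>W \<subseteq> V\<close>, an edge meeting \<open>W\<close> has both endpoints
  in this set, so it captures all nonzero terms of the energy of a function supported in
  \<open>W\<close>.\<close>

definition closed_nbhd :: "'v set \<Rightarrow> 'v set" where
  "closed_nbhd W = W \<union> (\<Union>x\<in>W. {y \<in> V. b x y \<noteq> 0})"

text \<open>The polarized energy of the subgraph induced on \<open>S\<close>; for finite
  \<open>S\<close> it is an ordinary finite sum.\<close>

definition energy_form :: "'v set \<Rightarrow> ('v \<Rightarrow> 'k) \<Rightarrow> ('v \<Rightarrow> 'k) \<Rightarrow> 'k" where
  "energy_form S u w = 1 / 2 * (\<Sum>x\<in>S. \<Sum>y\<in>S. (u x - u y) * (w x - w y) * b x y)"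

lemma finite_closed_nbhd: "finite W \<Longrightarrow> W \<subseteq> V \<Longrightarrow> finite (closed_nbhd W)"
  using locally_finite by (auto simp: closed_nbhd_def locally_finite_graph_def)

lemma closed_nbhd_subset: "W \<subseteq> V \<Longrightarrow> closed_nbhd W \<subseteq> V"
  by (auto simp: closed_nbhd_def)

lemma subset_closed_nbhd: "W \<subseteq> closed_nbhd W"
  by (auto simp: closed_nbhd_def)

lemma sum'_eq_sum:
  fixes f :: "'a \<Rightarrow> 'k"
  assumes "finite S" "S \<subseteq> T" "\<And>x. x \<in> T - S \<Longrightarrow> f x = 0"
  shows "sum' f T = sum f S"
  using assms sum.mono_neutral_left'[of S T f] sum.eq_sum[of S f] by metis

lemma energy_eq_energy_form:
  assumes "finite W" "W \<subseteq> V" "\<And>x. x \<in> V - W \<Longrightarrow> \<phi> x = 0"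
  shows "energy V b \<phi> = energy_form (closed_nbhd W) \<phi> \<phi>"
proof -
  let ?S = "closed_nbhd W"
  have fin: "finite ?S" and sub: "?S \<subseteq> V"
    using assms finite_closed_nbhd closed_nbhd_subset by auto
  have zero: "(\<phi> x - \<phi> y)\<^sup>2 * b x y = 0" if "(x, y) \<in> V \<times> V - ?S \<times> ?S" for x y
  proof (cases "b x y = 0 \<or> x \<notin> W \<and> y \<notin> W")
    case True
    with that show ?thesis using assms(3) by auto
  next
    case False
    with that have "(x, y) \<in> ?S \<times> ?S"
      using b_sym[of x y] by (auto simp: closed_nbhd_def)
    with that show ?thesis by blast
  qed
  have "sum' (\<lambda>(x, y). (\<phi> x - \<phi> y)\<^sup>2 * b x y) (V \<times> V)
      = sum (\<lambda>(x, y). (\<phi> x - \<phi> y)\<^sup>2 * b x y) (?S \<times> ?S)"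
  proof (rule sum'_eq_sum)
    fix p assume "p \<in> V \<times> V - ?S \<times> ?S"
    then show "(case p of (x, y) \<Rightarrow> (\<phi> x - \<phi> y)\<^sup>2 * b x y) = 0"
      using zero by (cases p) simp
  qed (use fin sub in auto)
  then show ?thesis
    by (simp add: energy_def energy_form_def sum.cartesian_product power2_eq_square)
qed

text \<open>Using the neighbourhood of all of \<open>W\<close> instead of that of \<open>x\<close>
  gives every vertex of \<open>W\<close> the same range of summation, as Green's formula
  requires.\<close>

lemma laplacian_eq_sum:
  assumes "finite W" "W \<subseteq> V" "x \<in> W"
  shows "m x * laplacian V b m u x = (\<Sum>y\<in>closed_nbhd W. (u x - u y) * b x y)"
proof -
  have "sum' (\<lambda>y. (u x - u y) * b x y) V = (\<Sum>y\<in>closed_nbhd W. (u x - u y) * b x y)"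
    using assms finite_closed_nbhd closed_nbhd_subset
    by (intro sum'_eq_sum) (auto simp: closed_nbhd_def)
  then show ?thesis
    using m_pos[of x] assms by (auto simp: laplacian_def)
qed

section \<open>Green's formula and energy estimates\<close>

text \<open>Summation by parts: exchanging \<open>x\<close> and \<open>y\<close> turns the terms
  with \<open>\<phi> y\<close> into the negatives of those with \<open>\<phi> x\<close>, so the
  double sum doubles and absorbs the factor \<open>1 / 2\<close>.\<close>

lemma green_formula:
  assumes "finite W" "W \<subseteq> V" "\<And>x. x \<in> V - W \<Longrightarrow> \<phi> x = 0"
  shows "energy_form (closed_nbhd W) u \<phi> = (\<Sum>x\<in>W. \<phi> x * (m x * laplacian V b m u x))"
proof -
  let ?S = "closed_nbhd W"
  have fin: "finite ?S" and sub: "?S \<subseteq> V"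
    using assms finite_closed_nbhd closed_nbhd_subset by auto
  let ?A = "\<Sum>x\<in>?S. \<Sum>y\<in>?S. (u x - u y) * \<phi> x * b x y"
  have "(\<Sum>x\<in>?S. \<Sum>y\<in>?S. (u x - u y) * \<phi> y * b x y) = (\<Sum>x\<in>?S. \<Sum>y\<in>?S. (u y - u x) * \<phi> x * b y x)"
    by (rule sum.swap)
  also have "\<dots> = (\<Sum>x\<in>?S. \<Sum>y\<in>?S. - ((u x - u y) * \<phi> x * b x y))"
  proof (intro sum.cong refl)
    fix x y assume "x \<in> ?S" "y \<in> ?S"
    then have "b y x = b x y" using sub b_sym by blast
    then show "(u y - u x) * \<phi> x * b y x = - ((u x - u y) * \<phi> x * b x y)"
      by (simp add: algebra_simps)
  qed
  also have "\<dots> = - ?A" by (simp add: sum_negf)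
  finally have "energy_form ?S u \<phi> = 1 / 2 * (?A - - ?A)"
    by (simp add: energy_form_def right_diff_distrib left_diff_distrib sum_subtractf)
  also have "\<dots> = ?A" by simp
  also have "\<dots> = (\<Sum>x\<in>W. \<Sum>y\<in>?S. (u x - u y) * \<phi> x * b x y)"
    using fin sub assms(3) subset_closed_nbhd by (intro sum.mono_neutral_right) auto
  also have "\<dots> = (\<Sum>x\<in>W. \<phi> x * (m x * laplacian V b m u x))"
    using assms by (intro sum.cong refl)
      (simp add: laplacian_eq_sum[OF assms(1,2)] sum_distrib_left algebra_simps)
  finally show ?thesis .
qed

lemma energy_form_nonneg: "S \<subseteq> V \<Longrightarrow> energy_form S u u \<ge> 0"
  unfolding energy_form_def
  by (auto intro!: sum_nonneg mult_nonneg_nonneg[OF zero_le_square] b_nonneg)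

lemma finitely_supportedE:
  assumes "\<phi> \<in> finitely_supported V"
  obtains W where "finite W" "W \<subseteq> V" "\<And>x. x \<in> V - W \<Longrightarrow> \<phi> x = 0"
  using assms by (intro that[of "{x \<in> V. \<phi> x \<noteq> 0}"]) (auto simp: finitely_supported_def)

lemma finitely_supportedI:
  "finite W \<Longrightarrow> (\<And>x. x \<in> V - W \<Longrightarrow> \<phi> x = 0) \<Longrightarrow> \<phi> \<in> finitely_supported V"
  by (auto simp: finitely_supported_def intro: finite_subset[of _ W])

lemma energy_nonneg: "\<phi> \<in> finitely_supported V \<Longrightarrow> energy V b \<phi> \<ge> 0"
  by (erule finitely_supportedE)
    (metis energy_eq_energy_form energy_form_nonneg closed_nbhd_subset)

text \<open>The edge contributes one of the nonnegative terms of the double sum, which is twice the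
  energy.\<close>

lemma edge_le_energy:
  assumes "\<phi> \<in> finitely_supported V" "x \<in> V" "y \<in> V"
  shows "(\<phi> x - \<phi> y)\<^sup>2 * b x y \<le> 2 * energy V b \<phi>"
proof -
  obtain W where W: "finite W" "W \<subseteq> V" "\<And>x. x \<in> V - W \<Longrightarrow> \<phi> x = 0"
    using assms(1) by (rule finitely_supportedE) blast
  \<comment> \<open>The vertices \<open>x\<close> and \<open>y\<close> may lie outside the support;
    adjoining them puts their pair into the finite sum.\<close>
  let ?W = "W \<union> {x, y}" and ?S = "closed_nbhd (W \<union> {x, y})"
  have W': "finite ?W" "?W \<subseteq> V" "\<And>x. x \<in> V - ?W \<Longrightarrow> \<phi> x = 0"
    using W assms by auto
  have fin: "finite ?S" and sub: "?S \<subseteq> V" and xy: "x \<in> ?S" "y \<in> ?S"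
    using W' finite_closed_nbhd closed_nbhd_subset subset_closed_nbhd[of ?W] by auto
  let ?f = "\<lambda>x y. (\<phi> x - \<phi> y) * (\<phi> x - \<phi> y) * b x y"
  have nn: "?f x y \<ge> 0" if "x \<in> ?S" "y \<in> ?S" for x y
    using that sub by (intro mult_nonneg_nonneg[OF zero_le_square] b_nonneg) auto
  have "?f x y \<le> (\<Sum>y\<in>?S. ?f x y)"
    using xy fin nn by (intro member_le_sum) auto
  also have "\<dots> \<le> (\<Sum>x\<in>?S. \<Sum>y\<in>?S. ?f x y)"
    using xy fin nn by (intro member_le_sum[of x ?S "\<lambda>x. \<Sum>y\<in>?S. ?f x y"] sum_nonneg) auto
  also have "\<dots> = 2 * energy V b \<phi>"
    using energy_eq_energy_form[of ?W \<phi>, OF W'] by (simp add: energy_form_def)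
  finally show ?thesis by (simp add: power2_eq_square)
qed

section \<open>The Dirichlet problem on finite sets\<close>

lemma connected_induct:
  assumes "x \<in> V" "a \<in> V" "R a"
    and step: "\<And>y z. y \<in> V \<Longrightarrow> z \<in> V \<Longrightarrow> b y z \<noteq> 0 \<Longrightarrow> R y \<Longrightarrow> R z"
  shows "R x"
proof -
  have "(a, x) \<in> edges V b ^^ n \<Longrightarrow> R x" for n x
    by (induction n arbitrary: x) (use assms in \<open>auto simp: edges_def\<close>)
  with connected assms(1,2) show ?thesis
    unfolding connected_graph_def by blast
qed

text \<open>Green's formula with both arguments equal to \<open>w\<close> gives energy
  \<open>0\<close>, so \<open>w\<close> is constant along edges; being \<open>0\<close> at
  \<open>a\<close>, it vanishes on the connected graph.\<close>

lemma harmonic_eq_0: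
  assumes "finite F" "F \<subseteq> V" "a \<in> V - F" "x \<in> V"
    and "\<And>x. x \<in> V - F \<Longrightarrow> w x = 0" "\<And>x. x \<in> F \<Longrightarrow> laplacian V b m w x = 0"
  shows "w x = 0"
proof -
  have en: "energy V b w = 0"
    using energy_eq_energy_form[of F w] green_formula[of F w w] assms by simp
  have fs: "w \<in> finitely_supported V"
    using assms by (intro finitely_supportedI[of F]) auto
  show ?thesis
  proof (rule connected_induct[of x a "\<lambda>x. w x = 0"])
    fix y z assume yz: "y \<in> V" "z \<in> V" "b y z \<noteq> 0" "w y = 0"
    then have "b y z > 0" using b_nonneg[of y z] by simp
    moreover have "(w y - w z)\<^sup>2 * b y z \<le> 0"
      using edge_le_energy[OF fs yz(1,2)] en by simp
    ultimately show "w z = 0"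
      using yz(4) by (simp add: mult_le_0_iff)
  qed (use assms in auto)
qed

lemma laplacian_add_scaled:
  assumes "x \<in> V"
  shows "laplacian V b m (\<lambda>y. u y + t * w y) x = laplacian V b m u x + t * laplacian V b m w x"
proof -
  have "m x * laplacian V b m (\<lambda>y. u y + t * w y) x
      = m x * laplacian V b m u x + t * (m x * laplacian V b m w x)"
    using assms laplacian_eq_sum[of "{x}" x]
    by (simp add: sum_distrib_left flip: sum.distrib) (simp add: algebra_simps)
  also have "\<dots> = m x * (laplacian V b m u x + t * laplacian V b m w x)"
    by (simp add: algebra_simps)
  finally show ?thesis using m_pos[OF assms] by simp
qed

text \<open>Vertices are added to \<open>F\<close> one at a time: a multiple of the solution with boundary value the
  indicator of the new vertex \<open>x\<close> corrects the Laplacian at \<open>x\<close>. It can do so because, by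
  uniqueness, this solution is not harmonic at \<open>x\<close>.\<close>

lemma dirichlet_problem:
  assumes "finite F" "F \<subseteq> V" "a \<in> V - F"
  shows "\<exists>u. (\<forall>x. x \<notin> F \<longrightarrow> u x = h x) \<and> (\<forall>x\<in>F. laplacian V b m u x = 0)"
  using assms
proof (induction F arbitrary: h rule: finite_induct)
  case empty
  then show ?case by auto
next
  case (insert x F)
  then have IH: "\<exists>u. (\<forall>x. x \<notin> F \<longrightarrow> u x = h x) \<and> (\<forall>x\<in>F. laplacian V b m u x = 0)" for h
    by auto
  obtain u where u: "\<And>y. y \<notin> F \<Longrightarrow> u y = h y" "\<And>y. y \<in> F \<Longrightarrow> laplacian V b m u y = 0"
    using IH[of h] by blast
  obtain w where w: "\<And>y. y \<notin> F \<Longrightarrow> w y = of_bool (y = x)"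
      "\<And>y. y \<in> F \<Longrightarrow> laplacian V b m w y = 0"
    using IH[of "\<lambda>y. of_bool (y = x)"] by blast
  have F: "F \<subseteq> V" "x \<in> V" "finite (insert x F)" "a \<in> V - insert x F"
    using insert.hyps insert.prems by auto
  have wx: "laplacian V b m w x \<noteq> 0"
  proof
    assume "laplacian V b m w x = 0"
    then have "w x = 0"
      using F w by (intro harmonic_eq_0[of "insert x F" a x w]) auto
    with w(1)[of x] insert.hyps show False by simp
  qed
  define t where "t = - laplacian V b m u x / laplacian V b m w x"
  have "laplacian V b m (\<lambda>y. u y + t * w y) y = 0" if "y \<in> insert x F" for y
  proof -
    have "y \<in> V" using that F by auto
    with that show ?thesis
      using u(2)[of y] w(2)[of y] wx
      unfolding laplacian_add_scaled[OF \<open>y \<in> V\<close>] by (auto simp: t_def)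
  qed
  moreover have "u y + t * w y = h y" if "y \<notin> insert x F" for y
    using that u(1) w(1) by simp
  ultimately show ?case
    by (intro exI[of _ "\<lambda>y. u y + t * w y"]) simp
qed

text \<open>Existence is the Dirichlet problem on \<open>K - {a}\<close> with the indicator of
  \<open>a\<close> as boundary values. For uniqueness, the difference of two solutions is harmonic
  on \<open>K - {a}\<close> and vanishes off it.\<close>

lemma ex1_capacity_potential:
  assumes "finite K" "K \<subseteq> V" "a \<in> K"
  shows "\<exists>!v. is_capacity_potential V b m K a v"
proof -
  have F: "finite (K - {a})" "K - {a} \<subseteq> V" "a \<in> V - (K - {a})"
    using assms by auto
  obtain v where v: "\<And>x. x \<notin> K - {a} \<Longrightarrow> v x = of_bool (x = a)"
      "\<And>x. x \<in> K - {a} \<Longrightarrow> laplacian V b m v x = 0"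
    using dirichlet_problem[OF F, of "\<lambda>x. of_bool (x = a)"] by blast
  show ?thesis
  proof (rule ex1I[of _ v])
    show "is_capacity_potential V b m K a v"
      using v assms by (auto simp: is_capacity_potential_def)
  next
    fix w assume w: "is_capacity_potential V b m K a w"
    show "w = v"
    proof
      fix x
      show "w x = v x"
      proof (cases "x \<in> V")
        case True
        have "w x + (- 1) * v x = 0"
        proof (rule harmonic_eq_0[OF F True])
          show "w y + (- 1) * v y = 0" if "y \<in> V - (K - {a})" for y
            using that w v(1)[of y] by (auto simp: is_capacity_potential_def)
          show "laplacian V b m (\<lambda>y. w y + (- 1) * v y) y = 0" if "y \<in> K - {a}" for y
          proof -
            have "y \<in> V" using that assms by auto
            then show ?thesis
              using that w v(2) unfolding laplacian_add_scaled[OF \<open>y \<in> V\<close>]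
              by (simp add: is_capacity_potential_def)
          qed
        qed
        then show ?thesis by simp
      next
        \<comment> \<open>Off \<open>V\<close> harmonicity says nothing; both functions are
          \<open>0\<close> here because the point is outside \<open>K\<close>.\<close>
        case False
        then have "x \<notin> K" "x \<noteq> a" using assms by auto
        then show ?thesis using w v(1)[of x] by (simp add: is_capacity_potential_def)
      qed
    qed
  qed
qed

section \<open>Capacity as a minimum of the energy\<close>

lemma energy_form_add_scaled:
  "energy_form S (\<lambda>x. t * v x + p x) (\<lambda>x. t * v x + p x)
    = t\<^sup>2 * energy_form S v v + 2 * t * energy_form S v p + energy_form S p p"
proof -
  let ?A = "\<lambda>x y. (v x - v y) * (v x - v y) * b x y"
    and ?B = "\<lambda>x y. (v x - v y) * (p x - p y) * b x y"
    and ?C = "\<lambda>x y. (p x - p y) * (p x - p y) * b x y"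
  have "(\<Sum>x\<in>S. \<Sum>y\<in>S. (t * v x + p x - (t * v y + p y)) * (t * v x + p x - (t * v y + p y)) * b x y)
      = (\<Sum>x\<in>S. \<Sum>y\<in>S. t\<^sup>2 * ?A x y + 2 * t * ?B x y + ?C x y)"
    by (intro sum.cong refl) (simp add: algebra_simps power2_eq_square)
  also have "\<dots> = t\<^sup>2 * (\<Sum>x\<in>S. \<Sum>y\<in>S. ?A x y) + 2 * t * (\<Sum>x\<in>S. \<Sum>y\<in>S. ?B x y)
      + (\<Sum>x\<in>S. \<Sum>y\<in>S. ?C x y)"
    by (simp only: sum.distrib sum_distrib_left)
  finally show ?thesis
    by (simp add: energy_form_def distrib_left)
qed

text \<open>The potential \<open>v\<close> attains the value, and \<open>\<phi>\<close> splits as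
  \<open>\<phi> a\<close> times \<open>v\<close> plus a function vanishing at \<open>a\<close>,
  which is orthogonal to \<open>v\<close> in the energy form.\<close>

lemma capacity_attained:
  assumes "finite K" "K \<subseteq> V" "a \<in> K"
  shows "\<exists>v \<in> finitely_supported V. v a = 1 \<and> capacity V b m K a = energy V b v"
    and "\<And>\<phi>. (\<And>x. x \<in> V - K \<Longrightarrow> \<phi> x = 0) \<Longrightarrow> capacity V b m K a * (\<phi> a)\<^sup>2 \<le> energy V b \<phi>"
proof -
  define v where "v = (THE v. is_capacity_potential V b m K a v)"
  have "is_capacity_potential V b m K a v"
    unfolding v_def using theI'[OF ex1_capacity_potential[OF assms]] .
  then have v: "\<And>x. x \<in> K - {a} \<Longrightarrow> laplacian V b m v x = 0" "v a = 1" "\<And>x. x \<notin> K \<Longrightarrow> v x = 0"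
    by (auto simp: is_capacity_potential_def)
  let ?S = "closed_nbhd K"
  \<comment> \<open>Pairing with \<open>v\<close> sees only the value at \<open>a\<close>, since
    \<open>v\<close> is harmonic on the rest of \<open>K\<close>.\<close>
  have form: "energy_form ?S v p = p a * capacity V b m K a"
    if "\<And>x. x \<in> V - K \<Longrightarrow> p x = 0" for p
  proof -
    have "energy_form ?S v p = (\<Sum>x\<in>K. p x * (m x * laplacian V b m v x))"
      using assms that by (intro green_formula)
    also have "\<dots> = (\<Sum>x\<in>{a}. p x * (m x * laplacian V b m v x))"
      using assms v by (intro sum.mono_neutral_right) auto
    finally show ?thesis by (simp add: capacity_def v_def mult.commute)
  qed
  have en: "energy V b p = energy_form ?S p p" if "\<And>x. x \<in> V - K \<Longrightarrow> p x = 0" for p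
    using energy_eq_energy_form[OF assms(1,2)] that .
  have "v \<in> finitely_supported V"
    using assms v by (intro finitely_supportedI[of K]) auto
  moreover have "capacity V b m K a = energy V b v"
    using en[of v] form[of v] v by simp
  ultimately show "\<exists>v \<in> finitely_supported V. v a = 1 \<and> capacity V b m K a = energy V b v"
    using v by auto
  fix \<phi> :: "'v \<Rightarrow> 'k" assume \<phi>: "\<And>x. x \<in> V - K \<Longrightarrow> \<phi> x = 0"
  define p where "p = (\<lambda>x. \<phi> x - \<phi> a * v x)"
  have p: "\<And>x. x \<in> V - K \<Longrightarrow> p x = 0" "p a = 0"
    using \<phi> v by (auto simp: p_def)
  have "\<phi> = (\<lambda>x. \<phi> a * v x + p x)" by (auto simp: p_def)
  then have "energy V b \<phi> = energy_form ?S (\<lambda>x. \<phi> a * v x + p x) (\<lambda>x. \<phi> a * v x + p x)"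
    using en[OF \<phi>] by simp
  also have "\<dots> = (\<phi> a)\<^sup>2 * capacity V b m K a + energy_form ?S p p"
    using form[of v] form[of p] v p by (simp add: energy_form_add_scaled)
  finally show "capacity V b m K a * (\<phi> a)\<^sup>2 \<le> energy V b \<phi>"
    using energy_form_nonneg[OF closed_nbhd_subset[OF assms(2)], of p] by (simp add: mult.commute)
qed

section \<open>Exhaustion by balls\<close>

lemma finite_graph_ball:
  assumes "a \<in> V"
  shows "finite (graph_ball V b n a)"
proof -
  have "finite {x. (a, x) \<in> edges V b ^^ k}" for k
  proof (induction k)
    case (Suc k)
    have "{x. (a, x) \<in> edges V b ^^ Suc k} \<subseteq> (\<Union>y\<in>{x. (a, x) \<in> edges V b ^^ k} \<inter> V. {z \<in> V. b y z \<noteq> 0})"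
      by (auto simp: edges_def)
    moreover have "finite \<dots>"
      using Suc locally_finite by (auto simp: locally_finite_graph_def)
    ultimately show ?case by (rule finite_subset)
  qed auto
  then have "finite (\<Union>k<n. {x. (a, x) \<in> edges V b ^^ k})" by auto
  moreover have "graph_ball V b n a \<subseteq> (\<Union>k<n. {x. (a, x) \<in> edges V b ^^ k})"
  proof
    fix x assume x: "x \<in> graph_ball V b n a"
    then obtain k where "(a, x) \<in> edges V b ^^ k"
      using connected assms by (auto simp: connected_graph_def graph_ball_def)
    \<comment> \<open>Connectedness provides some path length, so the \<open>LEAST\<close> in the
      distance is attained.\<close>
    then have "(a, x) \<in> edges V b ^^ graph_dist V b a x"
      unfolding graph_dist_def by (rule LeastI)
    with x show "x \<in> (\<Union>k<n. {x. (a, x) \<in> edges V b ^^ k})"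
      by (auto simp: graph_ball_def)
  qed
  ultimately show ?thesis by (rule rev_finite_subset)
qed

lemma graph_ball_subset: "graph_ball V b n a \<subseteq> V"
  by (auto simp: graph_ball_def)

lemma center_in_graph_ball:
  assumes "a \<in> V" "n > 0"
  shows "a \<in> graph_ball V b n a"
proof -
  have "graph_dist V b a a = 0"
    unfolding graph_dist_def by (rule Least_eq_0) simp
  with assms show ?thesis by (simp add: graph_ball_def)
qed

lemma finite_subset_graph_ball:
  assumes "finite W" "W \<subseteq> V"
  obtains N where "\<And>n. n \<ge> N \<Longrightarrow> W \<subseteq> graph_ball V b n a"
proof (rule that)
  \<comment> \<open>The \<open>Suc\<close> comes from the strict inequality in the ball. For empty
    \<open>W\<close> the value of \<open>Max\<close> is irrelevant.\<close>
  fix n assume n: "n \<ge> Suc (Max (graph_dist V b a ` W))"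
  show "W \<subseteq> graph_ball V b n a"
  proof
    fix x assume x: "x \<in> W"
    then have "graph_dist V b a x \<le> Max (graph_dist V b a ` W)"
      using assms by (intro Max_ge) auto
    with n have "graph_dist V b a x < n" by linarith
    with x assms show "x \<in> graph_ball V b n a" by (auto simp: graph_ball_def)
  qed
qed

section \<open>Point values controlled by the energy\<close>

text \<open>The condition \<open>P(a)\<close>: evaluation at \<open>a\<close> is bounded with
  respect to the energy.\<close>

definition energy_controls :: "'v \<Rightarrow> bool" where
  "energy_controls a \<longleftrightarrow> (\<exists>c>0. \<forall>\<phi>\<in>finitely_supported V. c * (\<phi> a)\<^sup>2 \<le> energy V b \<phi>)"

text \<open>A constant \<open>c\<close> for \<open>a\<close> bounds the capacities from below, by
  testing with the potentials. If no constant works, a \<open>\<phi>\<close> violating the bound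
  with \<open>c\<close> forces the capacity below \<open>c\<close> for every large ball containing
  its support.\<close>

lemma energy_controls_iff_not_converges:
  assumes "a \<in> V"
  shows "energy_controls a \<longleftrightarrow> \<not> converges_to (\<lambda>n. capacity V b m (graph_ball V b n a) a) 0"
proof
  assume "energy_controls a"
  then obtain c where c: "c > 0" "\<And>\<phi>. \<phi> \<in> finitely_supported V \<Longrightarrow> c * (\<phi> a)\<^sup>2 \<le> energy V b \<phi>"
    by (auto simp: energy_controls_def)
  \<comment> \<open>Radius \<open>0\<close> is excluded: the capacity of the empty ball is a junk
    value.\<close>
  have "c \<le> capacity V b m (graph_ball V b n a) a" if "n > 0" for n
    using capacity_attained(1)[OF finite_graph_ball[OF assms] graph_ball_subset
        center_in_graph_ball[OF assms that]] c(2) by fastforce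
  then have large: "c \<le> \<bar>capacity V b m (graph_ball V b n a) a - 0\<bar>" if "n > 0" for n
    using that by (metis abs_ge_self diff_zero order_trans)
  show "\<not> converges_to (\<lambda>n. capacity V b m (graph_ball V b n a) a) 0"
  proof
    assume "converges_to (\<lambda>n. capacity V b m (graph_ball V b n a) a) 0"
    then obtain N where "\<bar>capacity V b m (graph_ball V b n a) a - 0\<bar> \<le> c / 2" if "n \<ge> N" for n
      using c(1) unfolding converges_to_def by (metis half_gt_zero)
    from this[of "Suc N"] large[of "Suc N"] c(1) show False by simp
  qed
next
  assume not_conv: "\<not> converges_to (\<lambda>n. capacity V b m (graph_ball V b n a) a) 0"
  show "energy_controls a"
  proof (rule ccontr)
    assume not_ctrl: "\<not> energy_controls a"
    have "\<exists>N. \<forall>n\<ge>N. \<bar>capacity V b m (graph_ball V b n a) a - 0\<bar> \<le> c" if "c > 0" for c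
    proof -
      from not_ctrl that obtain \<phi> where \<phi>: "\<phi> \<in> finitely_supported V" "energy V b \<phi> < c * (\<phi> a)\<^sup>2"
        unfolding energy_controls_def by (meson not_le)
      obtain W where W: "finite W" "W \<subseteq> V" "\<And>x. x \<in> V - W \<Longrightarrow> \<phi> x = 0"
        using \<phi>(1) by (rule finitely_supportedE) blast
      obtain N where N: "\<And>n. n \<ge> N \<Longrightarrow> W \<subseteq> graph_ball V b n a"
        using finite_subset_graph_ball[OF W(1,2), of a] by blast
      \<comment> \<open>\<open>Suc N\<close> keeps the radius positive, so that the centre lies in
        the ball.\<close>
      have "\<bar>capacity V b m (graph_ball V b n a) a - 0\<bar> \<le> c" if n: "n \<ge> Suc N" for n
      proof -
        let ?K = "graph_ball V b n a"
        have K: "finite ?K" "?K \<subseteq> V" "a \<in> ?K"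
          using finite_graph_ball graph_ball_subset center_in_graph_ball assms n by auto
        have "capacity V b m ?K a * (\<phi> a)\<^sup>2 \<le> energy V b \<phi>"
          using W(3) N[of n] n by (intro capacity_attained(2)[OF K]) auto
        also note \<phi>(2)
        \<comment> \<open>The strict inequality already rules out \<open>\<phi> a = 0\<close>, so
          the square can be cancelled.\<close>
        finally have "capacity V b m ?K a < c"
          by (rule mult_right_less_imp_less) simp
        moreover have "capacity V b m ?K a \<ge> 0"
          using capacity_attained(1)[OF K] energy_nonneg by auto
        ultimately show ?thesis by simp
      qed
      then show ?thesis by blast
    qed
    with not_conv show False unfolding converges_to_def by blast
  qed
qed

text \<open>The values at \<open>x\<close> and \<open>y\<close> differ by the increment along the
  edge, whose square is at most \<open>2 * energy V b \<phi> / b x y\<close>.\<close>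

lemma energy_controls_step:
  assumes "x \<in> V" "y \<in> V" "b x y \<noteq> 0" "energy_controls x"
  shows "energy_controls y"
proof -
  obtain c where c: "c > 0" "\<And>\<phi>. \<phi> \<in> finitely_supported V \<Longrightarrow> c * (\<phi> x)\<^sup>2 \<le> energy V b \<phi>"
    using assms(4) by (auto simp: energy_controls_def)
  have bpos: "b x y > 0"
    using b_nonneg[OF assms(1,2)] assms(3) by simp
  \<comment> \<open>The two summands come from \<open>(\<phi> y)\<^sup>2 \<le> 2 * (\<phi>
    x)\<^sup>2 + 2 * (\<phi> x - \<phi> y)\<^sup>2\<close> and the estimates of the two squares by
    the energy.\<close>
  define D where "D = 2 / c + 4 / b x y"
  have D: "D > 0" using c(1) bpos by (simp add: D_def add_pos_pos)
  have "1 / D * (\<phi> y)\<^sup>2 \<le> energy V b \<phi>" if \<phi>: "\<phi> \<in> finitely_supported V" for \<phi>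
  proof -
    let ?d = "\<phi> x - \<phi> y"
    have "2 * (\<phi> x)\<^sup>2 + 2 * ?d\<^sup>2 - (\<phi> y)\<^sup>2 = (\<phi> x + ?d)\<^sup>2"
      by (simp add: power2_eq_square algebra_simps)
    also have "\<dots> \<ge> 0" by (rule zero_le_power2)
    finally have "(\<phi> y)\<^sup>2 \<le> 2 * (\<phi> x)\<^sup>2 + 2 * ?d\<^sup>2" by simp
    moreover have "(\<phi> x)\<^sup>2 \<le> energy V b \<phi> / c"
      using c(1) c(2)[OF \<phi>] by (simp add: pos_le_divide_eq mult.commute)
    moreover have "?d\<^sup>2 \<le> 2 * energy V b \<phi> / b x y"
      using bpos edge_le_energy[OF \<phi> assms(1,2)] by (simp add: pos_le_divide_eq)
    ultimately have "(\<phi> y)\<^sup>2 \<le> 2 * (energy V b \<phi> / c) + 2 * (2 * energy V b \<phi> / b x y)"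
      by linarith
    also have "\<dots> = D * energy V b \<phi>"
      by (simp add: D_def algebra_simps)
    finally show ?thesis using D by (simp add: pos_divide_le_eq mult.commute)
  qed
  then show ?thesis
    unfolding energy_controls_def using D by (intro exI[of _ "1 / D"]) auto
qed

text \<open>Control spreads over the connected graph, so the choice of the vertex in
  \<open>null_capacity\<close> is immaterial.\<close>

lemma not_null_capacity_iff:
  assumes "a \<in> V"
  shows "\<not> null_capacity V b m \<longleftrightarrow> energy_controls a"
proof -
  have "energy_controls y" if "x \<in> V" "y \<in> V" "energy_controls x" for x y
    using that(2,1,3) by (rule connected_induct) (rule energy_controls_step)
  then have "(\<forall>x\<in>V. energy_controls x) \<longleftrightarrow> energy_controls a"
    using assms by blast
  moreover have "\<not> null_capacity V b m \<longleftrightarrow> (\<forall>x\<in>V. energy_controls x)"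
    unfolding null_capacity_def using energy_controls_iff_not_converges by blast
  ultimately show ?thesis by blast
qed

section \<open>From weights to control of a value\<close>

text \<open>The reverse triangle inequality applies term by term, and taking absolute values keeps
  the support, hence the finite range of summation.\<close>

lemma energy_abs_le:
  assumes "\<phi> \<in> finitely_supported V"
  shows "energy V b (\<lambda>x. \<bar>\<phi> x\<bar>) \<le> energy V b \<phi>"
proof -
  obtain W where W: "finite W" "W \<subseteq> V" "\<And>x. x \<in> V - W \<Longrightarrow> \<phi> x = 0"
    using assms by (rule finitely_supportedE) blast
  have "(\<bar>\<phi> x\<bar> - \<bar>\<phi> y\<bar>) * (\<bar>\<phi> x\<bar> - \<bar>\<phi> y\<bar>) \<le> (\<phi> x - \<phi> y) * (\<phi> x - \<phi> y)" for x y
    using abs_triangle_ineq3[of "\<phi> x" "\<phi> y"] abs_le_square_iff[of "\<bar>\<phi> x\<bar> - \<bar>\<phi> y\<bar>" "\<phi> x - \<phi> y"]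
    by (simp add: power2_eq_square)
  then have "energy_form (closed_nbhd W) (\<lambda>x. \<bar>\<phi> x\<bar>) (\<lambda>x. \<bar>\<phi> x\<bar>) \<le> energy_form (closed_nbhd W) \<phi> \<phi>"
    unfolding energy_form_def using closed_nbhd_subset[OF W(2)]
    by (intro mult_left_mono sum_mono mult_right_mono) (auto intro: b_nonneg)
  then show ?thesis
    using energy_eq_energy_form[of W] W by simp
qed

lemma member_le_sum':
  fixes f :: "'v \<Rightarrow> 'k"
  assumes "finite W" "W \<subseteq> V" "\<And>x. x \<in> V - W \<Longrightarrow> f x = 0" "\<And>x. x \<in> V \<Longrightarrow> f x \<ge> 0" "a \<in> V"
  shows "f a \<le> sum' f V"
proof -
  have "f a \<le> sum f (insert a W)"
    using assms by (intro member_le_sum) auto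
  also have "\<dots> = sum' f V"
    using assms by (intro sum'_eq_sum[symmetric]) auto
  finally show ?thesis .
qed

text \<open>Dropping all terms except the one at \<open>a\<close> leaves the constant
  \<open>\<omega> a\<close>.\<close>

lemma energy_controls_of_hardy:
  assumes "\<And>x. x \<in> V \<Longrightarrow> \<omega> x \<ge> 0" "a \<in> V" "\<omega> a \<noteq> 0" "hardy_inequality V b \<omega>"
  shows "energy_controls a"
proof -
  have "\<omega> a * (\<phi> a)\<^sup>2 \<le> energy V b \<phi>" if \<phi>: "\<phi> \<in> finitely_supported V" for \<phi>
  proof -
    obtain W where W: "finite W" "W \<subseteq> V" "\<And>x. x \<in> V - W \<Longrightarrow> \<phi> x = 0"
      using \<phi> by (rule finitely_supportedE) blast
    have "(\<phi> a)\<^sup>2 * \<omega> a \<le> sum' (\<lambda>x. (\<phi> x)\<^sup>2 * \<omega> x) V"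
      by (rule member_le_sum'[OF W(1,2)]) (use W assms in auto)
    also have "\<dots> \<le> energy V b \<phi>"
      using assms(4) \<phi> by (auto simp: hardy_inequality_def)
    finally show ?thesis by (simp add: mult.commute)
  qed
  moreover have "\<omega> a > 0" using assms by (simp add: order_less_le)
  ultimately show ?thesis unfolding energy_controls_def by blast
qed

text \<open>For \<open>\<bar>\<phi>\<bar>\<close> all terms of the sum are nonnegative, so the one
  at \<open>a\<close> bounds it from below; squaring gives the constant
  \<open>(\<omega> a)\<^sup>2\<close>.\<close>

lemma energy_controls_of_square_hardy:
  assumes "\<And>x. x \<in> V \<Longrightarrow> \<omega> x \<ge> 0" "a \<in> V" "\<omega> a \<noteq> 0"
    and "\<And>\<phi>. \<phi> \<in> finitely_supported V \<Longrightarrow> (sum' (\<lambda>x. \<phi> x * \<omega> x) V)\<^sup>2 \<le> energy V b \<phi>"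
  shows "energy_controls a"
proof -
  have "(\<omega> a)\<^sup>2 * (\<phi> a)\<^sup>2 \<le> energy V b \<phi>" if \<phi>: "\<phi> \<in> finitely_supported V" for \<phi>
  proof -
    obtain W where W: "finite W" "W \<subseteq> V" "\<And>x. x \<in> V - W \<Longrightarrow> \<phi> x = 0"
      using \<phi> by (rule finitely_supportedE) blast
    have "\<bar>\<phi> a\<bar> * \<omega> a \<le> sum' (\<lambda>x. \<bar>\<phi> x\<bar> * \<omega> x) V"
      by (rule member_le_sum'[OF W(1,2)]) (use W assms in auto)
    then have "(\<bar>\<phi> a\<bar> * \<omega> a)\<^sup>2 \<le> (sum' (\<lambda>x. \<bar>\<phi> x\<bar> * \<omega> x) V)\<^sup>2"
      using assms by (intro power_mono) auto
    also have "\<dots> \<le> energy V b (\<lambda>x. \<bar>\<phi> x\<bar>)"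
      using \<phi> by (intro assms(4)) (auto simp: finitely_supported_def)
    also have "\<dots> \<le> energy V b \<phi>"
      using \<phi> by (rule energy_abs_le)
    finally show ?thesis by (simp add: power_mult_distrib mult.commute)
  qed
  moreover have "(\<omega> a)\<^sup>2 > 0" using assms by simp
  ultimately show ?thesis unfolding energy_controls_def by blast
qed

section \<open>From control of values to weights\<close>

text \<open>A weight \<open>e\<close> concentrated at \<open>a\<close> suffices: the squared sum is
  \<open>e * e * (\<phi> a)\<^sup>2\<close>, and \<open>e\<close> is chosen with
  \<open>e * e \<le> c\<close>.\<close>

lemma square_hardy_of_energy_controls:
  assumes "a \<in> V" "energy_controls a"
  shows "\<exists>\<omega>. (\<forall>x\<in>V. \<omega> x \<ge> 0) \<and> (\<exists>x\<in>V. \<omega> x \<noteq> 0) \<and>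
    (\<forall>\<phi>\<in>finitely_supported V. (sum' (\<lambda>x. \<phi> x * \<omega> x) V)\<^sup>2 \<le> energy V b \<phi>)"
proof -
  obtain c where c: "c > 0" "\<And>\<phi>. \<phi> \<in> finitely_supported V \<Longrightarrow> c * (\<phi> a)\<^sup>2 \<le> energy V b \<phi>"
    using assms by (auto simp: energy_controls_def)
  \<comment> \<open>\<open>c\<close> need not have a square root in the field\<close>
  define e where "e = min 1 c"
  have e: "e > 0" "e * e \<le> c"
    using c(1) mult_mono[of e 1 e c] by (auto simp: e_def)
  define \<omega> where "\<omega> = (\<lambda>x. if x = a then e else 0)"
  have "(sum' (\<lambda>x. \<phi> x * \<omega> x) V)\<^sup>2 \<le> energy V b \<phi>" if \<phi>: "\<phi> \<in> finitely_supported V" for \<phi>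
  proof -
    have "sum' (\<lambda>x. \<phi> x * \<omega> x) V = (\<Sum>x\<in>{a}. \<phi> x * \<omega> x)"
      using assms by (intro sum'_eq_sum) (auto simp: \<omega>_def)
    then have "(sum' (\<lambda>x. \<phi> x * \<omega> x) V)\<^sup>2 = e * e * (\<phi> a)\<^sup>2"
      by (simp add: \<omega>_def power2_eq_square algebra_simps)
    also have "\<dots> \<le> c * (\<phi> a)\<^sup>2" using e by (intro mult_right_mono) auto
    also have "\<dots> \<le> energy V b \<phi>" using c(2) \<phi> .
    finally show ?thesis .
  qed
  then show ?thesis
    using e assms(1) by (intro exI[of _ \<omega>]) (auto simp: \<omega>_def)
qed

text \<open>In a non-Archimedean field the powers of \<open>1 / 2\<close> do not tend to
  \<open>0\<close>, so the geometric series is replaced by a bound on its finite sums.\<close>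

lemma sum_half_powers_le_1:
  assumes "finite A"
  shows "(\<Sum>n\<in>A. (1 / 2 :: 'k) ^ Suc n) \<le> 1"
proof -
  have partial: "(\<Sum>n<N. (1 / 2 :: 'k) ^ Suc n) = 1 - (1 / 2) ^ N" for N
    by (induction N) (auto simp: algebra_simps)
  obtain N where "A \<subseteq> {..<N}"
    using finite_nat_iff_bounded assms by blast
  then have "(\<Sum>n\<in>A. (1 / 2 :: 'k) ^ Suc n) \<le> (\<Sum>n<N. (1 / 2) ^ Suc n)"
    by (intro sum_mono2) auto
  also have "\<dots> \<le> 1" by (simp only: partial) simp
  finally show ?thesis .
qed

text \<open>Damping the constants \<open>c x\<close> by powers of \<open>1 / 2\<close> along an
  enumeration of \<open>V\<close> keeps the weighted sum of the pointwise bounds below a single copy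
  of the energy.\<close>

lemma positive_hardy_of_energy_controls:
  assumes "\<And>x. x \<in> V \<Longrightarrow> energy_controls x"
  shows "\<exists>\<omega>. (\<forall>x\<in>V. \<omega> x > 0) \<and> hardy_inequality V b \<omega>"
proof -
  have "\<forall>x\<in>V. \<exists>c>0. \<forall>\<phi>\<in>finitely_supported V. c * (\<phi> x)\<^sup>2 \<le> energy V b \<phi>"
    using assms by (simp add: energy_controls_def)
  then obtain c where c: "\<And>x. x \<in> V \<Longrightarrow> c x > 0"
      "\<And>x \<phi>. x \<in> V \<Longrightarrow> \<phi> \<in> finitely_supported V \<Longrightarrow> c x * (\<phi> x)\<^sup>2 \<le> energy V b \<phi>"
    by metis
  let ?i = "to_nat_on V"
  define \<omega> where "\<omega> = (\<lambda>x. c x * (1 / 2) ^ Suc (?i x))"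
  have "sum' (\<lambda>x. (\<phi> x)\<^sup>2 * \<omega> x) V \<le> energy V b \<phi>" if \<phi>: "\<phi> \<in> finitely_supported V" for \<phi>
  proof -
    obtain W where W: "finite W" "W \<subseteq> V" "\<And>x. x \<in> V - W \<Longrightarrow> \<phi> x = 0"
      using \<phi> by (rule finitely_supportedE) blast
    have "sum' (\<lambda>x. (\<phi> x)\<^sup>2 * \<omega> x) V = (\<Sum>x\<in>W. c x * (\<phi> x)\<^sup>2 * (1 / 2) ^ Suc (?i x))"
      using W by (subst sum'_eq_sum[of W]) (auto simp: \<omega>_def algebra_simps intro!: sum.cong)
    also have "\<dots> \<le> (\<Sum>x\<in>W. energy V b \<phi> * (1 / 2) ^ Suc (?i x))"
      using W c \<phi> by (intro sum_mono mult_right_mono) auto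
    \<comment> \<open>Injectivity of the enumeration makes the exponents distinct.\<close>
    also have "\<dots> = energy V b \<phi> * (\<Sum>n\<in>?i ` W. (1 / 2) ^ Suc n)"
      using inj_on_subset[OF inj_on_to_nat_on[OF countable_V] W(2)]
      by (simp add: sum.reindex sum_distrib_left)
    also have "\<dots> \<le> energy V b \<phi> * 1"
      using W(1) energy_nonneg[OF \<phi>] by (intro mult_left_mono sum_half_powers_le_1) auto
    finally show ?thesis by simp
  qed
  then show ?thesis
    using c(1) by (intro exI[of _ \<omega>]) (auto simp: hardy_inequality_def \<omega>_def)
qed

end

theorem theorem6p2:
  fixes V :: "'v set"
    and b :: "'v \<Rightarrow> 'v \<Rightarrow> 'k::linordered_field"
    and m :: "'v \<Rightarrow> 'k"
  assumes "non_archimedean TYPE('k)"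
    and "cauchy_complete TYPE('k)"
    and "countable_cofinality TYPE('k)"
    and "weighted_graph V b m"
    and "infinite V"
    and "locally_finite_graph V b"
    and "connected_graph V b"
  shows
    "(\<not> null_capacity V b m \<longleftrightarrow>
        (\<exists>\<omega>::'v \<Rightarrow> 'k. (\<forall>x\<in>V. \<omega> x > 0) \<and> hardy_inequality V b \<omega>)) \<and>
     ((\<exists>\<omega>::'v \<Rightarrow> 'k. (\<forall>x\<in>V. \<omega> x > 0) \<and> hardy_inequality V b \<omega>) \<longleftrightarrow>
        (\<exists>\<omega>::'v \<Rightarrow> 'k. (\<forall>x\<in>V. \<omega> x \<ge> 0) \<and> (\<exists>x\<in>V. \<omega> x \<noteq> 0) \<and> hardy_inequality V b \<omega>)) \<and>
     ((\<exists>\<omega>::'v \<Rightarrow> 'k. (\<forall>x\<in>V. \<omega> x \<ge> 0) \<and> (\<exists>x\<in>V. \<omega> x \<noteq> 0) \<and> hardy_inequality V b \<omega>) \<longleftrightarrow>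
        (\<exists>\<omega>::'v \<Rightarrow> 'k. (\<forall>x\<in>V. \<omega> x \<ge> 0) \<and> (\<exists>x\<in>V. \<omega> x \<noteq> 0) \<and>
           (\<forall>\<phi>\<in>finitely_supported V. energy V b \<phi> \<ge> (sum' (\<lambda>x. \<phi> x * \<omega> x) V)\<^sup>2)))"
proof -
  interpret locally_finite_weighted_graph V b m
    using assms by unfold_locales
  obtain a where a: "a \<in> V"
    using \<open>infinite V\<close> by fastforce
  let ?i = "\<not> null_capacity V b m"
  let ?ii = "\<exists>\<omega>::'v \<Rightarrow> 'k. (\<forall>x\<in>V. \<omega> x > 0) \<and> hardy_inequality V b \<omega>"
  let ?iii = "\<exists>\<omega>::'v \<Rightarrow> 'k. (\<forall>x\<in>V. \<omega> x \<ge> 0) \<and> (\<exists>x\<in>V. \<omega> x \<noteq> 0) \<and> hardy_inequality V b \<omega>"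
  let ?iv = "\<exists>\<omega>::'v \<Rightarrow> 'k. (\<forall>x\<in>V. \<omega> x \<ge> 0) \<and> (\<exists>x\<in>V. \<omega> x \<noteq> 0) \<and>
    (\<forall>\<phi>\<in>finitely_supported V. energy V b \<phi> \<ge> (sum' (\<lambda>x. \<phi> x * \<omega> x) V)\<^sup>2)"
  have "?i \<Longrightarrow> ?ii"
    using positive_hardy_of_energy_controls not_null_capacity_iff by blast
  \<comment> \<open>The vertex \<open>a\<close> witnesses that a strictly positive weight is not
    identically zero.\<close>
  moreover have "?ii \<Longrightarrow> ?iii"
    using a by (metis order_less_imp_le order_less_irrefl)
  moreover have "?iii \<Longrightarrow> ?i"
    using energy_controls_of_hardy not_null_capacity_iff by blast
  moreover have "?i \<Longrightarrow> ?iv"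
    using square_hardy_of_energy_controls[OF a] not_null_capacity_iff[OF a] by blast
  moreover have "?iv \<Longrightarrow> ?i"
    using energy_controls_of_square_hardy not_null_capacity_iff by blast
  ultimately show ?thesis by blast
qed

end
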